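(* Let $X_{\mathrm{Mu}}\subset\mathbb{P}^3(\mathbb{C})$ be the quartic surface $$x^4+y^4+z^4+t^4-6(x^2y^2+x^2z^2+x^2t^2+y^2z^2+y^2t^2+z^2t^2)=0$$ and let $X'_{\mathrm{Mu}}\subset\mathbb{P}^3(\mathbb{C})$ be the quartic surface $$x^4+y^4+z^4+t^4+12xyzt=0.$$ There exists $g\in\mathrm{GL}_4(\mathbb{C})$ such that $g(X_{\mathrm{Mu}})=X'_{\mathrm{Mu}}$.
   Context: $\mathrm{GL}_4(\mathbb{C})$ acts on $\mathbb{P}^3(\mathbb{C})=\mathbb{P}(\mathbb{C}^4)$ in the natural way, with homogeneous coordinates $[x:y:z:t]$. *)

theory Defs
  imports "HOL-Analysis.Analysis"
begin

text \<open>The projective space of \<open>\<complex>\<^sup>4\<close> is the set of complex lines through the origin;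
  \<open>proj_point v\<close>, for \<open>v \<noteq> 0\<close>, is the point with homogeneous coordinates
  \<open>[v$1 : v$2 : v$3 : v$4]\<close>. Here \<open>vec.span\<close> is the span over the complex numbers, whereas
  the plain \<open>span\<close> would be the real one.\<close>

definition proj_point :: "complex ^ 4 \<Rightarrow> (complex ^ 4) set" where
  "proj_point v = vec.span {v}"

definition proj_space :: "(complex ^ 4) set set" where
  "proj_space = {proj_point v | v. v \<noteq> 0}"

definition GL4 :: "(complex ^ 4 ^ 4) set" where
  "GL4 = {g. invertible g}"

definition proj_action :: "complex ^ 4 ^ 4 \<Rightarrow> (complex ^ 4) set \<Rightarrow> (complex ^ 4) set" where
  "proj_action g L = (\<lambda>v. g *v v) ` L"

text \<open>Only meaningful for homogeneous \<open>F\<close>.\<close>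

definition proj_zeros :: "(complex ^ 4 \<Rightarrow> complex) \<Rightarrow> (complex ^ 4) set set" where
  "proj_zeros F = {L \<in> proj_space. \<forall>v\<in>L. F v = 0}"

definition quartic_Mu :: "complex ^ 4 \<Rightarrow> complex" where
  "quartic_Mu v = (let x = v $ 1; y = v $ 2; z = v $ 3; t = v $ 4 in
     x^4 + y^4 + z^4 + t^4
       - 6 * (x^2 * y^2 + x^2 * z^2 + x^2 * t^2 + y^2 * z^2 + y^2 * t^2 + z^2 * t^2))"

definition quartic_Mu' :: "complex ^ 4 \<Rightarrow> complex" where
  "quartic_Mu' v = (let x = v $ 1; y = v $ 2; z = v $ 3; t = v $ 4 in
     x^4 + y^4 + z^4 + t^4 + 12 * x * y * z * t)"

definition X_Mu :: "(complex ^ 4) set set" where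
  "X_Mu = proj_zeros quartic_Mu"

definition X_Mu' :: "(complex ^ 4) set set" where
  "X_Mu' = proj_zeros quartic_Mu'"

lemma proj_action_proj_point: "proj_action g (proj_point v) = proj_point (g *v v)"
  unfolding proj_action_def proj_point_def
  by (auto simp: vec.span_singleton vec.scale image_iff)

lemma proj_point_in_X_Mu_iff:
  assumes "v \<noteq> 0"
  shows "proj_point v \<in> X_Mu \<longleftrightarrow> quartic_Mu v = 0"
proof -
  have "quartic_Mu (c *s v) = c^4 * quartic_Mu v" for c
    by (simp add: quartic_Mu_def Let_def power_mult_distrib) algebra
  moreover have "v \<in> proj_point v"
    by (simp add: proj_point_def vec.span_base)
  ultimately show ?thesis
    using assms by (auto simp: X_Mu_def proj_zeros_def proj_space_def proj_point_def
        vec.span_singleton)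
qed

lemma proj_point_in_X_Mu'_iff:
  assumes "v \<noteq> 0"
  shows "proj_point v \<in> X_Mu' \<longleftrightarrow> quartic_Mu' v = 0"
proof -
  have "quartic_Mu' (c *s v) = c^4 * quartic_Mu' v" for c
    by (simp add: quartic_Mu'_def Let_def power_mult_distrib) algebra
  moreover have "v \<in> proj_point v"
    by (simp add: proj_point_def vec.span_base)
  ultimately show ?thesis
    using assms by (auto simp: X_Mu'_def proj_zeros_def proj_space_def proj_point_def
        vec.span_singleton)
qed

end

theory Submission
  imports Defs
begin

text \<open>Over the complex numbers, \<open>(x + \<i>y)\<^sup>4 + (x - \<i>y)\<^sup>4 = 2 (x\<^sup>4 - 6x\<^sup>2y\<^sup>2 + y\<^sup>4)\<close> and
  \<open>(x + \<i>y)(x - \<i>y) = x\<^sup>2 + y\<^sup>2\<close>, while \<open>(\<i>z + t)(\<i>z - t) = - (z\<^sup>2 + t\<^sup>2)\<close>. Substituting these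
  pairs for the coordinates turns the second quartic into twice the first.\<close>

definition Mu_matrix :: "complex ^ 4 ^ 4" where
  "Mu_matrix = vector [vector [1, \<i>, 0, 0], vector [1, -\<i>, 0, 0],
                       vector [0, 0, \<i>, 1], vector [0, 0, \<i>, -1]]"

text \<open>\<open>Mu_matrix\<close> is block diagonal; each 2x2 block is undone by taking half-sums
  and half-differences of its two coordinates, divided by \<open>\<i>\<close> for y and z.\<close>

definition Mu_matrix_inv :: "complex ^ 4 ^ 4" where
  "Mu_matrix_inv = vector [vector [1/2, 1/2, 0, 0], vector [-\<i>/2, \<i>/2, 0, 0],
                           vector [0, 0, -\<i>/2, -\<i>/2], vector [0, 0, 1/2, -1/2]]"

lemma vector_4_nth [simp]:
  "(vector [a, b, c, d] :: 'a::zero ^ 4) $ 1 = a"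
  "(vector [a, b, c, d] :: 'a::zero ^ 4) $ 2 = b"
  "(vector [a, b, c, d] :: 'a::zero ^ 4) $ 3 = c"
  "(vector [a, b, c, d] :: 'a::zero ^ 4) $ 4 = d"
  by (simp_all add: vector_def)

lemma invertible_Mu_matrix: "invertible Mu_matrix"
  unfolding invertible_def
  by (rule exI[of _ Mu_matrix_inv])
    (simp add: Mu_matrix_def Mu_matrix_inv_def vec_eq_iff forall_4 matrix_matrix_mult_def
      sum_4 mat_def)

text \<open>The fourth powers yield the mixed terms in x, y and in z, t; the product of the four
  forms, \<open>-(x^2 + y^2) * (z^2 + t^2)\<close>, yields the other four. The factor 2 does not
  affect the zero set.\<close>

lemma quartic_Mu'_Mu_matrix: "quartic_Mu' (Mu_matrix *v v) = 2 * quartic_Mu v"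
proof -
  have "(x + \<i> * y)^4 + (x - \<i> * y)^4 + (\<i> * z + t)^4 + (\<i> * z - t)^4
      + 12 * (x + \<i> * y) * (x - \<i> * y) * (\<i> * z + t) * (\<i> * z - t)
    = 2 * (x^4 + y^4 + z^4 + t^4
       - 6 * (x^2 * y^2 + x^2 * z^2 + x^2 * t^2 + y^2 * z^2 + y^2 * t^2 + z^2 * t^2))"
    for x y z t :: complex
    \<comment> \<open>A polynomial identity modulo the relation \<open>\<i>^2 = -1\<close>.\<close>
    using i_squared by algebra
  then show ?thesis
    by (simp add: quartic_Mu_def quartic_Mu'_def Let_def Mu_matrix_def
        matrix_vector_mult_def sum_4)
qed

text \<open>\<open>proj_zeros\<close> tests every vector of a line, so vanishing transfers pointwise
  along \<open>g\<close>; the inverse of \<open>g\<close> supplies preimages of lines.\<close>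

lemma proj_action_image_proj_zeros:
  assumes "invertible g" and "\<And>v. F' (g *v v) = 0 \<longleftrightarrow> F v = 0"
  shows "proj_action g ` proj_zeros F = proj_zeros F'"
proof -
  obtain h where h: "g ** h = mat 1" "h ** g = mat 1"
    using assms(1) by (auto simp: invertible_def)
  have gh: "g *v (h *v v) = v" and hg: "h *v (g *v v) = v" for v
    by (simp_all add: matrix_vector_mul_assoc h)
  have nz: "g *v v \<noteq> 0 \<longleftrightarrow> v \<noteq> 0" for v
    by (metis hg matrix_vector_mult_0_right)
  have "proj_action g L \<in> proj_zeros F'" if L: "L \<in> proj_zeros F" for L
  proof -
    obtain v where "v \<noteq> 0" "L = proj_point v"
      using L by (auto simp: proj_zeros_def proj_space_def)
    then have "proj_action g L \<in> proj_space"
      using nz by (auto simp: proj_space_def proj_action_proj_point)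
    then show ?thesis
      using L assms(2) by (auto simp: proj_zeros_def proj_action_def)
  qed
  moreover have "L \<in> proj_action g ` proj_zeros F" if L: "L \<in> proj_zeros F'" for L
  proof -
    obtain w where w: "w \<noteq> 0" "L = proj_point w"
      using L by (auto simp: proj_zeros_def proj_space_def)
    define K where "K = proj_point (h *v w)"
    have LK: "L = proj_action g K"
      by (simp add: K_def w proj_action_proj_point gh)
    have "K \<in> proj_space"
      \<comment> \<open>\<open>h *v w\<close> is nonzero because \<open>g\<close> sends it to the
        nonzero \<open>w\<close>.\<close>
      using nz[of "h *v w"] w by (auto simp: K_def gh proj_space_def)
    moreover have "\<forall>v\<in>K. F v = 0"
      using L assms(2) by (auto simp: LK proj_zeros_def proj_action_def)
    ultimately show ?thesis
      by (auto simp: LK proj_zeros_def)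
  qed
  ultimately show ?thesis by blast
qed

theorem proposition4p1: "\<exists>g\<in>GL4. proj_action g ` X_Mu = X_Mu'"
proof
  show "Mu_matrix \<in> GL4"
    by (simp add: GL4_def invertible_Mu_matrix)
  show "proj_action Mu_matrix ` X_Mu = X_Mu'"
    unfolding X_Mu_def X_Mu'_def
    by (rule proj_action_image_proj_zeros)
      (simp_all add: invertible_Mu_matrix quartic_Mu'_Mu_matrix)
qed

end
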